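(* Let $n=4m+3$ for some $m\in\mathbb{N}\cup\{0\}$ and let $s\in\{2,3,4\}$. Then $$Z_{\sqrt s}h_n(\tfrac ps,0)=s^{1/4}\sum_{k\in\mathbb{Z}}h_n\bigl(\sqrt s\,(k+\tfrac ps)\bigr)=0\quad\text{for } p\in\{0,1,\dots,s-1\}.$$
   Context: The $n$th Hermite function is $h_n(x)=c_n^{-1/2}e^{\pi x^2}\frac{d^n}{dx^n}e^{-2\pi x^2}$ with $c_n=(2\pi)^n2^{n-1/2}n!$, $n\in\mathbb{N}\cup\{0\}$. For $\lambda>0$ the Zak transform is $Z_\lambda f(x,\gamma)=\sqrt\lambda\sum_{k\in\mathbb{Z}}f(\lambda(x+k))e^{-2\pi ik\gamma}$, $x,\gamma\in\mathbb{R}$; for $f=h_n$ the series converges absolutely for every $(x,\gamma)$ and the values are understood pointwise. *)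

theory Defs
  imports "HOL-Analysis.Analysis"
begin

definition hermite_const :: "nat \<Rightarrow> real" where
  "hermite_const n = (2 * pi) ^ n * 2 powr (real n - 1 / 2) * fact n"

definition hermite_fun :: "nat \<Rightarrow> real \<Rightarrow> real" where
  "hermite_fun n x =
     hermite_const n powr (- 1 / 2) * exp (pi * x\<^sup>2)
       * (deriv ^^ n) (\<lambda>t. exp (- 2 * pi * t\<^sup>2)) x"

text \<open>
  The sum over the integers is the unordered sum. Since \<^const>\<open>infsum\<close> is 0 for families
  that are not summable, \<open>zak\<close> gives the pointwise value of the Zak transform only where
  the series converges absolutely.
\<close>

definition zak :: "real \<Rightarrow> (real \<Rightarrow> complex) \<Rightarrow> real \<Rightarrow> real \<Rightarrow> complex" where
  "zak l f x \<gamma> =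
     complex_of_real (sqrt l) *
       (\<Sum>\<^sub>\<infinity>k::int. f (l * (x + of_int k)) *
          exp (- 2 * complex_of_real pi * \<i> * of_int k * complex_of_real \<gamma>))"

end

theory Submission
  imports Defs "HOL-Complex_Analysis.Complex_Analysis" "HOL-Real_Asymp.Real_Asymp"
begin

text \<open>
  The Hermite functions are eigenfunctions of the Fourier transform: the transform of \<open>h\<^sub>n\<close> is
  \<open>(- i)\<^sup>n h\<^sub>n\<close>, and \<open>(- i)\<^sup>n = i\<close> for \<open>n = 4 m + 3\<close>. Put
  \<open>D\<^sub>p = (\<Sum>k. h\<^sub>n (sqrt s (k + p / s)))\<close>. Poisson summation, with the dual sum split into residue
  classes mod \<open>s\<close>, turns the eigenvalue equation into
  \<open>D\<^sub>p = i C (\<Sum>q<s. e\<^bsup>2\<pi>ipq/s\<^esup> D\<^sub>q)\<close> with a constant \<open>C \<ge> 0\<close>, while oddness of \<open>h\<^sub>n\<close> gives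
  \<open>D\<^bsub>s - p\<^esub> = - D\<^sub>p\<close>, where \<open>D\<^sub>s = D\<^sub>0\<close>. So \<open>D\<^sub>0\<close> and \<open>D\<^bsub>s/2\<^esub>\<close> vanish, which settles \<open>s = 2\<close>,
  and for \<open>s = 3\<close> and \<open>s = 4\<close> the only unknown left is \<open>D\<^sub>1\<close>. It satisfies
  \<open>D\<^sub>1 = i C (2 i sin (2 \<pi> / s)) D\<^sub>1\<close>, a multiple of \<open>D\<^sub>1\<close> by a factor \<open>\<le> 0\<close>, hence \<open>D\<^sub>1 = 0\<close>.

  Since only the sign of \<open>C\<close> enters, no Gaussian integral has to be evaluated. Moreover all \<open>n\<close>
  are handled at once, without Fourier transforms of the \<open>h\<^sub>n\<close>, through the generating function
  \<open>e\<^bsup>\<pi>y\<^sup>2\<^esup> e\<^bsup>-2\<pi>(y+t)\<^sup>2\<^esup> = e\<^bsup>2\<pi>t\<^sup>2\<^esup> e\<^bsup>-\<pi>(y+2t)\<^sup>2\<^esup>\<close>, whose \<open>n\<close>-th derivative in \<open>t\<close> at \<open>0\<close> is \<open>h\<^sub>n y\<close> up to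
  normalisation. Summed over \<open>y = sqrt s (k + p / s)\<close>, it becomes
  \<open>e\<^bsup>2\<pi>t\<^sup>2\<^esup> \<theta> (p / s + 2 t / sqrt s)\<close> with the theta function
  \<open>\<theta> z = (\<Sum>k. e\<^bsup>-\<pi>s(z+k)\<^sup>2\<^esup>)\<close>, and Poisson summation for \<open>\<theta>\<close> (\<open>theta_Poisson\<close>) becomes a relation
  between the generating functions at \<open>t\<close> and at \<open>- i t\<close> (\<open>theta_gen_Poisson\<close>); the factor
  \<open>(- i)\<^sup>n\<close> appears on comparing \<open>n\<close>-th derivatives at \<open>0\<close>.

  Poisson summation for \<open>\<theta>\<close> is obtained inside complex analysis. An entire function of period 1 is
  the sum of its Fourier series (\<open>Fourier_series\<close>), and \<open>\<theta> (z + i / s) = e\<^bsup>\<pi>/s - 2\<pi>iz\<^esup> \<theta> z\<close> forces the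
  Fourier coefficients to be \<open>c\<^sub>0 e\<^bsup>-\<pi>l\<^sup>2/s\<^esup>\<close> (\<open>Fourier_coeff_theta\<close>).
\<close>

section \<open>Series of entire functions and their derivatives\<close>

text \<open>
  Completing the square bounds the quadratic exponent by \<open>B - \<bar>k\<bar>\<close>, so that a geometric series
  dominates. The linear term accounts for a complex shift of the Gaussian.
\<close>

lemma summable_gaussian_int:
  fixes a b c :: real
  assumes "a > 0"
  shows "(\<lambda>k::int. exp (- a * (of_int k)\<^sup>2 + b * \<bar>of_int k\<bar> + c)) summable_on UNIV"
proof -
  \<comment> \<open>\<open>b + 1\<close> instead of \<open>b\<close>: one unit of the linear term is kept for the decay \<open>exp (- \<bar>x\<bar>)\<close>\<close>
  define B where "B = (b + 1)\<^sup>2 / (4 * a) + c"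
  have bound: "exp (- a * x\<^sup>2 + b * \<bar>x\<bar> + c) \<le> exp B * exp (- \<bar>x\<bar>)" for x :: real
  proof -
    have "(2 * a * \<bar>x\<bar> - (b + 1))\<^sup>2 \<ge> 0" by simp
    hence "(b + 1) * \<bar>x\<bar> - a * x\<^sup>2 \<le> (b + 1)\<^sup>2 / (4 * a)"
      using assms by (simp add: field_simps power2_eq_square)
    thus ?thesis unfolding B_def by (simp add: algebra_simps flip: exp_add)
  qed
  have geo: "(\<lambda>n::nat. exp (- real n)) summable_on UNIV"
  proof (rule norm_summable_imp_summable_on)
    have "norm (exp (- real n)) = exp (- 1) ^ n" for n
      by (simp flip: exp_of_nat_mult)
    thus "summable (\<lambda>n. norm (exp (- real n)))"
      by (simp add: summable_geometric)
  qed
  have "(\<lambda>k::int. exp (- \<bar>of_int k\<bar> :: real)) summable_on (range int \<union> range (\<lambda>n. - int n))"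
    by (rule summable_on_union; subst summable_on_reindex)
       (auto simp: inj_on_def o_def geo)
  also have "range int \<union> range (\<lambda>n. - int n) = UNIV"
    by (auto simp: image_iff) (metis int_cases2)
  finally have "(\<lambda>k::int. exp B * exp (- \<bar>of_int k\<bar>)) summable_on UNIV"
    by (rule summable_on_cmult_right)
  thus ?thesis
    by (rule summable_on_comparison_test) (use bound in auto)
qed

text \<open>
  Locally uniform domination by a summable family makes the partial sums converge uniformly on discs,
  and by Cauchy's formula derivatives of all orders pass to such limits. Sums over an arbitrary index
  set are used so that bilateral series need no reordering.
\<close>

lemma
  fixes F :: "'i \<Rightarrow> complex \<Rightarrow> complex"
  assumes hol: "\<And>k. F k holomorphic_on UNIV"
    and dom: "\<And>R. \<exists>M. M summable_on UNIV \<and> (\<forall>k z. norm z < R \<longrightarrow> norm (F k z) \<le> M k)"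
  shows summable_normal: "(\<lambda>k. F k z) summable_on UNIV"
    and holomorphic_infsum_normal: "(\<lambda>z. \<Sum>\<^sub>\<infinity>k. F k z) holomorphic_on UNIV"
    and higher_deriv_infsum_normal:
      "((\<lambda>k. (deriv ^^ n) (F k) z) has_sum (deriv ^^ n) (\<lambda>z. \<Sum>\<^sub>\<infinity>k. F k z) z) UNIV"
proof -
  have unif: "uniform_limit (ball 0 R) (\<lambda>X z. \<Sum>k\<in>X. F k z) (\<lambda>z. \<Sum>\<^sub>\<infinity>k. F k z)
      (finite_subsets_at_top UNIV)" for R
    using dom[of R] by (auto intro!: Weierstrass_m_test_general)
  obtain M where M: "M summable_on UNIV" "\<And>k w. norm w < norm z + 1 \<Longrightarrow> norm (F k w) \<le> M k"
    using dom[of "norm z + 1"] by blast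
  have "(\<lambda>k. norm (F k z)) summable_on UNIV"
    by (rule summable_on_comparison_test[OF M(1)]) (use M(2)[of z] in auto)
  thus "(\<lambda>k. F k z) summable_on UNIV"
    by (rule abs_summable_summable)
  show "(\<lambda>z. \<Sum>\<^sub>\<infinity>k. F k z) holomorphic_on UNIV"
  proof -
    have "(\<lambda>z. \<Sum>\<^sub>\<infinity>k. F k z) holomorphic_on ball 0 R" for R
    proof (rule holomorphic_uniform_limit[where F = "finite_subsets_at_top UNIV"])
      show "uniform_limit (cball 0 R) (\<lambda>X z. \<Sum>k\<in>X. F k z) (\<lambda>z. \<Sum>\<^sub>\<infinity>k. F k z)
          (finite_subsets_at_top UNIV)"
        by (rule uniform_limit_on_subset[OF unif[of "R + 1"]]) auto
      show "\<forall>\<^sub>F X in finite_subsets_at_top UNIV. continuous_on (cball 0 R) (\<lambda>z. \<Sum>k\<in>X. F k z)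
          \<and> (\<lambda>z. \<Sum>k\<in>X. F k z) holomorphic_on ball 0 R"
        by (intro always_eventually allI conjI holomorphic_on_imp_continuous_on holomorphic_intros
            holomorphic_on_subset[OF hol] subset_UNIV)
    qed auto
    hence "(\<lambda>z. \<Sum>\<^sub>\<infinity>k. F k z) holomorphic_on (\<Union>R. ball 0 R)"
      by (subst holomorphic_on_UN_open) auto
    also have "(\<Union>R. ball 0 R) = (UNIV :: complex set)"
      by (auto intro: gt_ex)
    finally show ?thesis .
  qed
  have "((\<lambda>X. (deriv ^^ n) (\<lambda>z. \<Sum>k\<in>X. F k z) z) \<longlongrightarrow> (deriv ^^ n) (\<lambda>z. \<Sum>\<^sub>\<infinity>k. F k z) z)
      (finite_subsets_at_top UNIV)"
    by (rule higher_deriv_complex_uniform_limit[OF unif[of "norm z + 1"]])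
       (auto intro!: always_eventually holomorphic_intros holomorphic_on_subset[OF hol])
  moreover have "(deriv ^^ n) (\<lambda>z. \<Sum>k\<in>X. F k z) z = (\<Sum>k\<in>X. (deriv ^^ n) (F k) z)"
    if "finite X" for X
    using that
  proof (induction X rule: finite_induct)
    case (insert x X)
    have "(deriv ^^ n) (\<lambda>z. F x z + (\<Sum>k\<in>X. F k z)) z
        = (deriv ^^ n) (F x) z + (deriv ^^ n) (\<lambda>z. \<Sum>k\<in>X. F k z) z"
      by (rule higher_deriv_add[of _ UNIV]) (auto intro!: holomorphic_intros hol)
    with insert show ?case by simp
  qed auto
  ultimately show "((\<lambda>k. (deriv ^^ n) (F k) z) has_sum (deriv ^^ n) (\<lambda>z. \<Sum>\<^sub>\<infinity>k. F k z) z) UNIV"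
    unfolding has_sum_def
    by (elim Lim_transform_eventually) (auto intro!: eventually_finite_subsets_at_top_weakI)
qed

text \<open>
  Restricting to the real line, the derivative of the imaginary part is that of the zero function, so
  the complex derivative is real and agrees with the derivative of the real part. Iterated, this
  identifies the real derivatives defining the Hermite functions with complex ones.
\<close>

lemma deriv_of_real:
  assumes hol: "F holomorphic_on UNIV" and F: "\<And>x. F (of_real x) = of_real (f x)"
  shows "deriv F (of_real x) = complex_of_real (deriv f x)"
proof -
  define D where "D = deriv F (of_real x)"
  have "((\<lambda>x. of_real x) has_vector_derivative (1 :: complex)) (at x)"
    by (rule derivative_eq_intros refl | simp)+
  from field_vector_diff_chain_at[OF this holomorphic_derivI[OF hol open_UNIV]]
  have D: "((\<lambda>x. complex_of_real (f x)) has_vector_derivative D) (at x)"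
    by (simp add: o_def F D_def)
  have Re: "(f has_real_derivative Re D) (at x)"
    using bounded_linear.has_vector_derivative[OF bounded_linear_Re D]
    by (simp add: has_real_derivative_iff_has_vector_derivative)
  have "((\<lambda>x. 0 :: real) has_real_derivative Im D) (at x)"
    using bounded_linear.has_vector_derivative[OF bounded_linear_Im D]
    by (simp add: has_real_derivative_iff_has_vector_derivative)
  hence "Im D = 0"
    using DERIV_unique[OF _ DERIV_const] by blast
  with DERIV_imp_deriv[OF Re] show ?thesis
    by (simp add: D_def complex_eq_iff)
qed

lemma higher_deriv_of_real:
  assumes hol: "F holomorphic_on UNIV" and F: "\<And>x. F (of_real x) = of_real (f x)"
  shows "(deriv ^^ n) F (of_real x) = complex_of_real ((deriv ^^ n) f x)"
proof (induction n arbitrary: x)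
  case (Suc n)
  show ?case
    using deriv_of_real[OF holomorphic_higher_deriv[OF hol open_UNIV] Suc.IH] by simp
qed (simp add: F)

section \<open>Fourier series of periodic entire functions\<close>

definition fourier_exp :: "int \<Rightarrow> complex \<Rightarrow> complex" where
  "fourier_exp l z = exp (2 * of_real pi * \<i> * of_int l * z)"

lemma fourier_exp_0 [simp]: "fourier_exp 0 z = 1" "fourier_exp l 0 = 1"
  by (auto simp: fourier_exp_def)

lemma fourier_exp_add_freq: "fourier_exp (l + m) z = fourier_exp l z * fourier_exp m z"
  by (simp add: fourier_exp_def ring_distribs exp_add)

lemma fourier_exp_add: "fourier_exp l (z + w) = fourier_exp l z * fourier_exp l w"
  by (simp add: fourier_exp_def ring_distribs exp_add)

lemma fourier_exp_add_int [simp]: "fourier_exp l (z + of_int j) = fourier_exp l z"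
proof -
  have "fourier_exp l (of_int j) = 1"
    unfolding fourier_exp_def exp_eq_1 by (auto intro!: exI[of _ "l * j"])
  thus ?thesis by (simp add: fourier_exp_add)
qed

lemma fourier_exp_add_1 [simp]: "fourier_exp l (z + 1) = fourier_exp l z"
  using fourier_exp_add_int[of l z 1] by simp

lemma norm_fourier_exp_of_real [simp]: "norm (fourier_exp l (of_real x)) = 1"
  by (simp add: fourier_exp_def)

lemma holomorphic_fourier_exp [holomorphic_intros]:
  "f holomorphic_on A \<Longrightarrow> (\<lambda>z. fourier_exp l (f z)) holomorphic_on A"
  unfolding fourier_exp_def by (intro holomorphic_intros)

lemma fourier_exp_1_eq_1_iff: "fourier_exp 1 z = 1 \<longleftrightarrow> z \<in> \<int>"
proof
  assume "fourier_exp 1 z = 1"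
  then obtain n :: int where "Re (2 * of_real pi * \<i> * z) = 0" "Im (2 * of_real pi * \<i> * z) = of_int (2 * n) * pi"
    by (auto simp: fourier_exp_def exp_eq_1)
  hence "z = of_int n" by (simp add: complex_eq_iff)
  thus "z \<in> \<int>" by simp
next
  assume "z \<in> \<int>"
  then obtain n where "z = of_int n" by (elim Ints_cases)
  thus "fourier_exp 1 z = 1" using fourier_exp_add_int[of 1 0 n] by simp
qed

lemma has_integral_unit_segment:
  fixes g :: "complex \<Rightarrow> complex"
  assumes G: "\<And>x. x \<in> {0..1} \<Longrightarrow> (G has_field_derivative g (w + of_real x)) (at (w + of_real x))"
  shows "((\<lambda>x. g (w + of_real x)) has_integral G (w + 1) - G w) {0..1}"
proof -
  have "((\<lambda>x. g (w + of_real x)) has_integral G (w + of_real 1) - G (w + of_real 0)) {0..1}"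
  proof (rule fundamental_theorem_of_calculus)
    fix x :: real
    assume x: "x \<in> {0..1}"
    have "((\<lambda>x. w + of_real x) has_vector_derivative 1) (at x)"
      by (rule derivative_eq_intros refl | simp)+
    from field_vector_diff_chain_at[OF this G[OF x]]
    show "((\<lambda>x. G (w + of_real x)) has_vector_derivative g (w + of_real x)) (at x within {0..1})"
      by (simp add: o_def has_vector_derivative_at_within)
  qed auto
  thus ?thesis by simp
qed

text \<open>
  If \<open>G\<close> is a primitive of \<open>g\<close>, then \<open>G (u + 1) - G u\<close> has derivative \<open>g (u + 1) - g u = 0\<close> and does not
  depend on \<open>u\<close>. The base point \<open>w\<close> may be complex: this replaces a contour shift.
\<close>

lemma has_integral_period:
  fixes g :: "complex \<Rightarrow> complex"
  assumes hol: "g holomorphic_on UNIV" and per: "\<And>z. g (z + 1) = g z"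
  shows "((\<lambda>x. g (w + of_real x)) has_integral integral {0..1} (\<lambda>x. g (of_real x))) {0..1}"
proof -
  obtain G where G: "\<And>z. (G has_field_derivative g z) (at z)"
    using holomorphic_convex_primitive'[OF convex_UNIV open_UNIV hol] by auto
  have int: "((\<lambda>x. g (u + of_real x)) has_integral G (u + 1) - G u) {0..1}" for u
    by (rule has_integral_unit_segment) (rule G)
  have "((\<lambda>u. G (u + 1) - G u) has_field_derivative 0) (at u)" for u
  proof -
    have "((\<lambda>u. G (u + 1)) has_field_derivative g u) (at u)"
      using G[of "u + 1"] by (simp add: DERIV_shift per)
    from DERIV_diff[OF this G[of u]] show ?thesis by simp
  qed
  then obtain c where "\<And>u. G (u + 1) - G u = c"
    using has_field_derivative_zero_constant[of UNIV "\<lambda>u. G (u + 1) - G u"] by auto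
  hence "((\<lambda>x. g (u + of_real x)) has_integral c) {0..1}" for u
    using int[of u] by simp
  from this[of w] integral_unique[OF this[of 0]] show ?thesis
    by simp
qed

text \<open>
  The denominator \<open>fourier_exp 1 z - 1\<close> has in the unit disc only the simple zero at \<open>0\<close>, which the zero
  of \<open>f\<close> cancels.
\<close>

lemma removable_quotient:
  assumes hol: "f holomorphic_on UNIV" and f0: "f 0 = 0"
  obtains q where "q holomorphic_on ball 0 1" "\<And>z. norm z < 1 \<Longrightarrow> f z = q z * (fourier_exp 1 z - 1)"
proof -
  have nz: "fourier_exp 1 z \<noteq> 1" if "z \<in> ball 0 1 - {0}" for z
  proof
    assume "fourier_exp 1 z = 1"
    then obtain n :: int where n: "z = of_int n"
      by (auto simp: fourier_exp_1_eq_1_iff elim: Ints_cases)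
    hence "norm z = of_int \<bar>n\<bar>" by simp
    with n that show False by auto
  qed
  have "((\<lambda>z. (f z - f 0) / (z - 0)) \<longlongrightarrow> deriv f 0) (at 0)"
    using holomorphic_derivI[OF hol, of 0] by (simp add: has_field_derivative_iff)
  moreover have "((\<lambda>z. (fourier_exp 1 z - fourier_exp 1 0) / (z - 0)) \<longlongrightarrow> 2 * of_real pi * \<i>) (at 0)"
    unfolding has_field_derivative_iff[symmetric] unfolding fourier_exp_def
    by (auto intro!: derivative_eq_intros)
  ultimately have "((\<lambda>z. ((f z - f 0) / (z - 0)) / ((fourier_exp 1 z - fourier_exp 1 0) / (z - 0)))
      \<longlongrightarrow> deriv f 0 / (2 * of_real pi * \<i>)) (at 0)"
    by (rule tendsto_divide) auto
  moreover have "\<forall>\<^sub>F z in at 0. ((f z - f 0) / (z - 0)) / ((fourier_exp 1 z - fourier_exp 1 0) / (z - 0))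
      = f z / (fourier_exp 1 z - 1)"
    using eventually_neq_at_within[of 0 0 UNIV] by eventually_elim (auto simp: f0)
  ultimately have lim: "((\<lambda>z. f z / (fourier_exp 1 z - 1)) \<longlongrightarrow> deriv f 0 / (2 * of_real pi * \<i>)) (at 0)"
    by (rule Lim_transform_eventually)
  show thesis
  proof (rule that)
    show "(\<lambda>z. if z = 0 then deriv f 0 / (2 * of_real pi * \<i>) else f z / (fourier_exp 1 z - 1))
        holomorphic_on ball 0 1"
      by (rule removable_singularity[OF _ _ lim])
         (use nz in \<open>auto intro!: holomorphic_intros holomorphic_on_subset[OF hol]\<close>)
    show "f z = (if z = 0 then deriv f 0 / (2 * of_real pi * \<i>) else f z / (fourier_exp 1 z - 1)) * (fourier_exp 1 z - 1)"
      if "norm z < 1" for z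
      using nz[of z] that by (auto simp: f0)
  qed
qed

text \<open>
  The period is centred at \<open>0\<close> so that it lies in the unit disc, where the quotient above is holomorphic.
\<close>

lemma mem_unit_ball: "- 1 / 2 + complex_of_real x \<in> ball 0 1" if "x \<in> {0..1}"
proof -
  have "- 1 / 2 + complex_of_real x = of_real (x - 1 / 2)" by simp
  also have "norm \<dots> < 1" unfolding norm_of_real using that by auto
  finally show ?thesis by simp
qed

lemma fourier_exp_derivative: "(fourier_exp l has_field_derivative 2 * of_real pi * \<i> * of_int l * fourier_exp l z) (at z)"
  unfolding fourier_exp_def by (auto intro!: derivative_eq_intros)

lemma Fourier_integrand_continuous:
  assumes "q holomorphic_on ball 0 1"
  shows "continuous_on {0..1} (\<lambda>x. q (- 1 / 2 + of_real x) * fourier_exp l (- 1 / 2 + of_real x))"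
proof (rule continuous_on_compose2[of "ball 0 1" "\<lambda>z. q z * fourier_exp l z"])
  show "(\<lambda>x. - 1 / 2 + complex_of_real x) ` {0..1} \<subseteq> ball 0 1"
    using mem_unit_ball by blast
qed (auto intro!: holomorphic_on_imp_continuous_on holomorphic_intros assms continuous_intros)

text \<open>
  Integration by parts: integrate the derivative of \<open>q z * fourier_exp l z\<close>; the boundary terms and the
  integral of \<open>deriv q\<close> are bounded independently of \<open>l\<close>.
\<close>

lemma Riemann_Lebesgue_holomorphic:
  assumes hol: "q holomorphic_on ball 0 1"
  obtains K where "\<And>l. l \<noteq> 0 \<Longrightarrow>
    norm (integral {0..1} (\<lambda>x. q (- 1 / 2 + of_real x) * fourier_exp l (- 1 / 2 + of_real x))) \<le> K / \<bar>of_int l\<bar>"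
proof -
  have hol': "deriv q holomorphic_on ball 0 1"
    by (rule holomorphic_deriv[OF hol]) auto
  have norm1: "norm (fourier_exp l (- 1 / 2 + of_real x)) = 1" for l x
    using norm_fourier_exp_of_real[of l "- 1 / 2 + x"] by simp
  have "compact ((\<lambda>x. deriv q (- 1 / 2 + of_real x)) ` {0..1})"
    using Fourier_integrand_continuous[OF hol', of 0] by (intro compact_continuous_image) auto
  then obtain B where B: "\<And>x. x \<in> {0..1} \<Longrightarrow> norm (deriv q (- 1 / 2 + of_real x)) \<le> B"
    by (meson bounded_iff compact_imp_bounded imageI)
  define K where "K = (B + norm (q (1 / 2)) + norm (q (- 1 / 2))) / (2 * pi)"
  have "norm (integral {0..1} (\<lambda>x. q (- 1 / 2 + of_real x) * fourier_exp l (- 1 / 2 + of_real x))) \<le> K / \<bar>of_int l\<bar>"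
    if "l \<noteq> 0" for l
  proof -
    let ?w = "\<lambda>x. - 1 / 2 + complex_of_real x"
    define I where "I = integral {0..1} (\<lambda>x. q (?w x) * fourier_exp l (?w x))"
    define J where "J = integral {0..1} (\<lambda>x. deriv q (?w x) * fourier_exp l (?w x))"
    let ?c = "2 * of_real pi * \<i> * of_int l :: complex"
    have I: "((\<lambda>x. q (?w x) * fourier_exp l (?w x)) has_integral I) {0..1}"
      unfolding I_def by (intro integrable_integral integrable_continuous_real Fourier_integrand_continuous hol)
    have J: "((\<lambda>x. deriv q (?w x) * fourier_exp l (?w x)) has_integral J) {0..1}"
      unfolding J_def by (intro integrable_integral integrable_continuous_real Fourier_integrand_continuous hol')
    have "((\<lambda>x. deriv q (?w x) * fourier_exp l (?w x) + ?c * (q (?w x) * fourier_exp l (?w x)))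
        has_integral q (- 1 / 2 + 1) * fourier_exp l (- 1 / 2 + 1) - q (- 1 / 2) * fourier_exp l (- 1 / 2)) {0..1}"
    proof (rule has_integral_unit_segment[where g = "\<lambda>z. deriv q z * fourier_exp l z + ?c * (q z * fourier_exp l z)"])
      fix x :: real assume x: "x \<in> {0..1}"
      have "(q has_field_derivative deriv q (?w x)) (at (?w x))"
        by (rule holomorphic_derivI[OF hol open_ball mem_unit_ball[OF x]])
      from DERIV_mult[OF this fourier_exp_derivative[of l]]
      show "((\<lambda>z. q z * fourier_exp l z) has_field_derivative
          deriv q (?w x) * fourier_exp l (?w x) + ?c * (q (?w x) * fourier_exp l (?w x))) (at (?w x))"
        by (simp add: mult_ac)
    qed
    hence "q (- 1 / 2 + 1) * fourier_exp l (- 1 / 2 + 1) - q (- 1 / 2) * fourier_exp l (- 1 / 2) = J + ?c * I"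
      by (rule has_integral_unique[OF _ has_integral_add[OF J has_integral_mult_right[OF I]]])
    moreover have "- 1 / 2 + 1 = (1 / 2 :: complex)" by simp
    ultimately have "?c * I = q (1 / 2) * fourier_exp l (- 1 / 2 + 1) - q (- 1 / 2) * fourier_exp l (- 1 / 2) - J"
      by (metis add_diff_cancel_left')
    hence "norm (?c * I) \<le> norm (q (1 / 2) * fourier_exp l (- 1 / 2 + 1)) + norm (q (- 1 / 2) * fourier_exp l (- 1 / 2)) + norm J"
      by (simp only:) (rule order_trans[OF norm_triangle_ineq4 add_right_mono[OF norm_triangle_ineq4]])
    also have "norm J \<le> B * (1 - 0)"
      unfolding J_def
    proof (rule integral_bound)
      show "norm (deriv q (?w x) * fourier_exp l (?w x)) \<le> B" if "x \<in> {0..1}" for x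
        unfolding norm_mult norm1 using B[OF that] by simp
    qed (auto simp only: zero_le_one intro!: Fourier_integrand_continuous hol')
    finally have "2 * pi * \<bar>of_int l\<bar> * norm I \<le> B + norm (q (1 / 2)) + norm (q (- 1 / 2))"
      using norm1[of l 0] norm1[of l 1] by (simp add: norm_mult)
    hence "norm I \<le> K / \<bar>of_int l\<bar>" using that by (simp add: K_def field_simps)
    thus ?thesis unfolding I_def .
  qed
  thus thesis by (rule that)
qed

definition Fourier_coeff :: "(complex \<Rightarrow> complex) \<Rightarrow> int \<Rightarrow> complex" where
  "Fourier_coeff f l = integral {0..1} (\<lambda>x. f (of_real x) * fourier_exp (- l) (of_real x))"

lemma Fourier_coeff_translate:
  assumes hol: "f holomorphic_on UNIV" and per: "\<And>z. f (z + 1) = f z"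
  shows "((\<lambda>x. f (w + of_real x) * fourier_exp (- l) (w + of_real x)) has_integral Fourier_coeff f l) {0..1}"
  unfolding Fourier_coeff_def
  by (rule has_integral_period[of "\<lambda>z. f z * fourier_exp (- l) z"]) (auto intro!: holomorphic_intros hol simp: per)

lemma has_integral_fourier_exp: "((\<lambda>x. fourier_exp l (w + of_real x)) has_integral (if l = 0 then 1 else 0)) {0..1}"
proof (cases "l = 0")
  case True
  thus ?thesis using has_integral_const_real[of "1::complex" 0 1] by simp
next
  case False
  have "((\<lambda>x. fourier_exp l (w + of_real x)) has_integral
      fourier_exp l (w + 1) / (2 * of_real pi * \<i> * of_int l) - fourier_exp l w / (2 * of_real pi * \<i> * of_int l)) {0..1}"
  proof (rule has_integral_unit_segment)
    show "((\<lambda>z. fourier_exp l z / (2 * of_real pi * \<i> * of_int l)) has_field_derivative fourier_exp l u) (at u)" for u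
      using DERIV_cdivide[OF fourier_exp_derivative[of l u], of "2 * of_real pi * \<i> * of_int l"] False by simp
  qed
  with False show ?thesis by simp
qed

text \<open>
  Chernoff's argument: with \<open>f z - f 0 = q z * (fourier_exp 1 z - 1)\<close>, the \<open>l\<close>-th coefficient of
  \<open>f - f 0\<close> is the difference of two consecutive Fourier integrals of \<open>q\<close>. The symmetric partial sums
  telescope, and the remaining end terms tend to \<open>0\<close> by the Riemann-Lebesgue lemma.
\<close>

lemma Fourier_series_at_0:
  assumes hol: "f holomorphic_on UNIV" and per: "\<And>z. f (z + 1) = f z"
  shows "(\<lambda>N. \<Sum>l\<in>{- int N..int N}. Fourier_coeff f l) \<longlonglongrightarrow> f 0"
proof -
  let ?w = "\<lambda>x. - 1 / 2 + complex_of_real x"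
  obtain q where q: "q holomorphic_on ball 0 1"
      "\<And>z. norm z < 1 \<Longrightarrow> f z - f 0 = q z * (fourier_exp 1 z - 1)"
    by (rule removable_quotient[of "\<lambda>z. f z - f 0"]) (auto intro!: holomorphic_intros hol)
  define d where "d l = integral {0..1} (\<lambda>x. q (?w x) * fourier_exp (- l) (?w x))" for l
  have d: "((\<lambda>x. q (?w x) * fourier_exp (- l) (?w x)) has_integral d l) {0..1}" for l
    unfolding d_def by (intro integrable_integral integrable_continuous_real Fourier_integrand_continuous q(1))
  have coeff: "Fourier_coeff f l = (if l = 0 then f 0 else 0) + (d (l - 1) - d l)" for l
  proof -
    have "((\<lambda>x. f 0 * fourier_exp (- l) (?w x)
        + (q (?w x) * fourier_exp (- (l - 1)) (?w x) - q (?w x) * fourier_exp (- l) (?w x)))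
        has_integral f 0 * (if - l = 0 then 1 else 0) + (d (l - 1) - d l)) {0..1}"
      by (intro has_integral_add has_integral_diff d has_integral_mult_right has_integral_fourier_exp)
    also have "?this \<longleftrightarrow> ((\<lambda>x. f (?w x) * fourier_exp (- l) (?w x))
        has_integral f 0 * (if - l = 0 then 1 else 0) + (d (l - 1) - d l)) {0..1}"
    proof (rule has_integral_cong)
      fix x :: real assume "x \<in> {0..1}"
      hence "f (?w x) = f 0 + q (?w x) * (fourier_exp 1 (?w x) - 1)"
        using q(2)[of "?w x"] mem_unit_ball[of x] by (simp add: algebra_simps)
      thus "f 0 * fourier_exp (- l) (?w x) + (q (?w x) * fourier_exp (- (l - 1)) (?w x) - q (?w x) * fourier_exp (- l) (?w x))
          = f (?w x) * fourier_exp (- l) (?w x)"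
        using fourier_exp_add_freq[of 1 "- l" "?w x"] by (simp add: ring_distribs mult.assoc)
    qed
    finally show ?thesis
      using has_integral_unique[OF Fourier_coeff_translate[OF hol per, of "- 1 / 2" l]] by auto
  qed
  have sum: "(\<Sum>l\<in>{- int N..int N}. Fourier_coeff f l) = f 0 + (d (- int N - 1) - d (int N))" for N
  proof (induction N)
    case (Suc N)
    have "{- int (Suc N)..int (Suc N)} = insert (- int N - 1) (insert (int N + 1) {- int N..int N})"
      by auto
    with Suc show ?case by (simp add: coeff algebra_simps)
  qed (simp add: coeff)
  obtain K where K: "\<And>l. l \<noteq> 0 \<Longrightarrow> norm (d (- l)) \<le> K / \<bar>of_int l\<bar>"
    using Riemann_Lebesgue_holomorphic[OF q(1)] unfolding d_def by auto
  have "(\<lambda>N. d (- int N - 1)) \<longlonglongrightarrow> 0"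
  proof (rule Lim_null_comparison)
    show "\<forall>\<^sub>F N in sequentially. norm (d (- int N - 1)) \<le> K / (real N + 1)"
    proof (intro always_eventually allI)
      fix N
      have eq: "- (int N + 1) = - int N - 1" by simp
      show "norm (d (- int N - 1)) \<le> K / (real N + 1)"
        using K[of "int N + 1"] unfolding eq by (simp add: add.commute)
    qed
    show "(\<lambda>N. K / (real N + 1)) \<longlonglongrightarrow> 0" by real_asymp
  qed
  moreover have "(\<lambda>N. d (int N)) \<longlonglongrightarrow> 0"
  proof (rule Lim_null_comparison)
    show "\<forall>\<^sub>F N in sequentially. norm (d (int N)) \<le> K / real N"
      using eventually_gt_at_top[of 0] by eventually_elim (use K[of "- int _"] in force)
    show "(\<lambda>N. K / real N) \<longlonglongrightarrow> 0" by real_asymp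
  qed
  ultimately have "(\<lambda>N. f 0 + (d (- int N - 1) - d (int N))) \<longlonglongrightarrow> f 0 + (0 - 0)"
    by (intro tendsto_intros)
  thus ?thesis by (simp add: sum)
qed

text \<open>
  Translating \<open>f\<close> by \<open>z\<close> multiplies its \<open>l\<close>-th coefficient by \<open>fourier_exp l z\<close>.
\<close>

lemma Fourier_series:
  assumes hol: "f holomorphic_on UNIV" and per: "\<And>z. f (z + 1) = f z"
  shows "(\<lambda>N. \<Sum>l\<in>{- int N..int N}. Fourier_coeff f l * fourier_exp l z) \<longlonglongrightarrow> f z"
proof -
  have "(\<lambda>N. \<Sum>l\<in>{- int N..int N}. Fourier_coeff (\<lambda>w. f (z + w)) l) \<longlonglongrightarrow> f (z + 0)"
    using per[of "z + _"]
    by (intro Fourier_series_at_0)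
       (auto simp: add_ac intro!: holomorphic_on_compose[OF _ holomorphic_on_subset[OF hol], unfolded o_def] holomorphic_intros)
  moreover have "Fourier_coeff (\<lambda>w. f (z + w)) l = Fourier_coeff f l * fourier_exp l z" for l
  proof -
    have "fourier_exp (- l) z * fourier_exp l z = 1" for z
      using fourier_exp_add_freq[of "- l" l z] by simp
    hence "(\<lambda>x. f (z + of_real x) * fourier_exp (- l) (z + of_real x) * fourier_exp l z)
        = (\<lambda>x. f (z + of_real x) * fourier_exp (- l) (of_real x))"
      by (simp add: fourier_exp_add mult_ac fun_eq_iff)
    hence "((\<lambda>x. f (z + of_real x) * fourier_exp (- l) (of_real x)) has_integral Fourier_coeff f l * fourier_exp l z) {0..1}"
      using has_integral_mult_left[OF Fourier_coeff_translate[OF hol per, of z l], of "fourier_exp l z"]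
      by (simp only:)
    thus ?thesis unfolding Fourier_coeff_def[of "\<lambda>w. f (z + w)"] by (rule integral_unique)
  qed
  ultimately show ?thesis by simp
qed

section \<open>Poisson summation for the Gaussian theta function\<close>

lemma has_sum_imp_symmetric_limit:
  fixes f :: "int \<Rightarrow> 'a :: {comm_monoid_add, topological_space}"
  assumes "(f has_sum S) UNIV"
  shows "(\<lambda>N. \<Sum>l\<in>{- int N..int N}. f l) \<longlonglongrightarrow> S"
proof -
  have "filterlim (\<lambda>N. {- int N..int N}) (finite_subsets_at_top UNIV) sequentially"
    unfolding filterlim_finite_subsets_at_top
  proof (intro allI impI)
    fix X :: "int set" assume "finite X \<and> X \<subseteq> UNIV"
    then obtain B where B: "\<And>x. x \<in> X \<Longrightarrow> \<bar>x\<bar> \<le> B"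
      by (meson Max_ge finite_imageI imageI)
    show "\<forall>\<^sub>F N in sequentially. finite {- int N..int N} \<and> X \<subseteq> {- int N..int N} \<and> {- int N..int N} \<subseteq> UNIV"
      using eventually_ge_at_top[of "nat B"] by eventually_elim (use B in force)
  qed
  with assms show ?thesis
    unfolding has_sum_def by (rule filterlim_compose)
qed

definition theta :: "real \<Rightarrow> complex \<Rightarrow> complex" where
  "theta a z = (\<Sum>\<^sub>\<infinity>k::int. exp (- of_real (pi * a) * (z + of_int k)\<^sup>2))"

text \<open>
  With \<open>z = x + i y\<close> the exponent has real part \<open>- \<pi> a ((x + k)\<^sup>2 - y\<^sup>2)\<close>.
\<close>

lemma norm_theta_term_le:
  fixes z :: complex
  assumes "a > 0" "norm z < R"
  shows "norm (exp (- of_real (pi * a) * (z + of_int k)\<^sup>2))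
    \<le> exp (- (pi * a) * (of_int k)\<^sup>2 + (2 * pi * a * R) * \<bar>of_int k\<bar> + pi * a * R\<^sup>2)"
proof -
  have R: "\<bar>Re z\<bar> \<le> R" "\<bar>Im z\<bar> \<le> R"
    using assms(2) abs_Re_le_cmod[of z] abs_Im_le_cmod[of z] by linarith+
  have "- (of_int k * Re z) \<le> \<bar>of_int k\<bar> * \<bar>Re z\<bar>"
    by (simp flip: abs_mult)
  also have "\<dots> \<le> \<bar>of_int k\<bar> * R"
    by (intro mult_left_mono R) auto
  finally have 1: "- (of_int k * Re z) \<le> R * \<bar>of_int k\<bar>" by (simp add: mult.commute)
  have 2: "(Im z)\<^sup>2 \<le> R\<^sup>2" using R(2) by (rule abs_le_square_iff[THEN iffD1, OF order_trans]) auto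
  have "(Im z)\<^sup>2 - (Re z + of_int k)\<^sup>2 \<le> - (of_int k)\<^sup>2 + 2 * (R * \<bar>of_int k\<bar>) + R\<^sup>2"
  proof -
    have "(Re z + of_int k)\<^sup>2 = (Re z)\<^sup>2 + 2 * (of_int k * Re z) + (of_int k)\<^sup>2"
      by (simp add: power2_sum)
    thus ?thesis using 1 2 zero_le_power2[of "Re z"] by linarith
  qed
  from mult_left_mono[OF this, of "pi * a"] assms(1)
  have "- (pi * a) * ((Re z + of_int k)\<^sup>2 - (Im z)\<^sup>2)
      \<le> - (pi * a) * (of_int k)\<^sup>2 + (2 * pi * a * R) * \<bar>of_int k\<bar> + pi * a * R\<^sup>2"
    by (simp add: algebra_simps)
  also have "(Re z + of_int k)\<^sup>2 - (Im z)\<^sup>2 = Re ((z + of_int k)\<^sup>2)"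
    by (simp add: power2_eq_square)
  finally show ?thesis
    by simp
qed

lemma theta_dominated:
  assumes "a > 0"
  shows "\<exists>M. M summable_on UNIV \<and>
    (\<forall>k z. norm z < R \<longrightarrow> norm (exp (- of_real (pi * a) * (z + of_int k)\<^sup>2) :: complex) \<le> M (k::int))"
proof (intro exI conjI allI impI)
  show "(\<lambda>k::int. exp (- (pi * a) * (of_int k)\<^sup>2 + (2 * pi * a * R) * \<bar>of_int k\<bar> + pi * a * R\<^sup>2)) summable_on UNIV"
    using assms by (intro summable_gaussian_int) simp
qed (rule norm_theta_term_le[OF assms])

lemma theta_holomorphic:
  assumes "a > 0"
  shows "theta a holomorphic_on UNIV"
  unfolding theta_def[abs_def]
  by (rule holomorphic_infsum_normal[OF _ theta_dominated[OF assms]]) (intro holomorphic_intros)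

lemma theta_add_1: "theta a (z + 1) = theta a z"
  unfolding theta_def
  by (rule infsum_reindex_bij_witness[of _ "\<lambda>k. k - 1" "\<lambda>k. k + 1"]) (auto simp: algebra_simps)

lemma theta_minus: "theta a (- z) = theta a z"
  unfolding theta_def
  by (rule infsum_reindex_bij_witness[of _ uminus uminus]) (auto simp: power2_eq_square algebra_simps)

text \<open>
  Expanding the square, the shift by \<open>i / a\<close> changes the \<open>k\<close>-th exponent by \<open>\<pi> / a - 2 \<pi> i (z + k)\<close>, whose
  exponential is the same for all integers \<open>k\<close>.
\<close>

lemma theta_quasiperiod:
  assumes "a > 0"
  shows "theta a (\<i> / of_real a + z) = of_real (exp (pi / a)) * fourier_exp (- 1) z * theta a z"
proof -
  have "exp (- of_real (pi * a) * (\<i> / of_real a + z + of_int k)\<^sup>2)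
      = of_real (exp (pi / a)) * fourier_exp (- 1) z * exp (- of_real (pi * a) * (z + of_int k)\<^sup>2)" for k :: int
  proof -
    have "- of_real (pi * a) * (\<i> / of_real a + z + of_int k)\<^sup>2
        = of_real (pi / a) + 2 * of_real pi * \<i> * of_int (- 1) * (z + of_int k)
          + (- of_real (pi * a) * (z + of_int k)\<^sup>2)"
      using assms by (simp add: power2_eq_square field_simps)
    hence "exp (- of_real (pi * a) * (\<i> / of_real a + z + of_int k)\<^sup>2)
      = of_real (exp (pi / a)) * fourier_exp (- 1) (z + of_int k) * exp (- of_real (pi * a) * (z + of_int k)\<^sup>2)"
      by (simp only: exp_add fourier_exp_def exp_of_real)
    thus ?thesis by simp
  qed
  thus ?thesis unfolding theta_def by (simp only: infsum_cmult_right')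
qed

text \<open>
  Computing the \<open>l\<close>-th coefficient along the segment from \<open>i / a\<close> to \<open>i / a + 1\<close>, the quasi-period turns
  it into a multiple of the coefficient of index \<open>l + 1\<close>. The resulting recursion says that
  \<open>e\<^bsup>\<pi>l\<^sup>2/a\<^esup> c\<^sub>l\<close> is constant in \<open>l\<close>.
\<close>

lemma Fourier_coeff_theta:
  assumes a: "a > 0"
  shows "Fourier_coeff (theta a) l = of_real (exp (- pi * (of_int l)\<^sup>2 / a)) * Fourier_coeff (theta a) 0"
proof -
  define c where "c = Fourier_coeff (theta a)"
  have step: "c l = of_real (exp (pi * (2 * of_int l + 1) / a)) * c (l + 1)" for l
  proof -
    have "fourier_exp (- l) (\<i> / of_real a) = of_real (exp (2 * pi * of_int l / a))"
      by (simp add: fourier_exp_def mult_ac flip: exp_of_real)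
    hence "theta a (\<i> / of_real a + x) * fourier_exp (- l) (\<i> / of_real a + x)
        = of_real (exp (pi * (2 * of_int l + 1) / a)) * (theta a (0 + x) * fourier_exp (- (l + 1)) (0 + x))" for x
      using fourier_exp_add_freq[of "- l" "- 1" x]
      by (simp add: theta_quasiperiod[OF a] fourier_exp_add exp_add add_divide_distrib ring_distribs mult_ac)
    hence "((\<lambda>x. of_real (exp (pi * (2 * of_int l + 1) / a)) * (theta a (0 + of_real x) * fourier_exp (- (l + 1)) (0 + of_real x)))
        has_integral c l) {0..1}"
      using Fourier_coeff_translate[OF theta_holomorphic[OF a] theta_add_1, of "\<i> / of_real a" l]
      by (simp only: c_def)
    moreover have "((\<lambda>x. of_real (exp (pi * (2 * of_int l + 1) / a)) * (theta a (0 + of_real x) * fourier_exp (- (l + 1)) (0 + of_real x)))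
        has_integral of_real (exp (pi * (2 * of_int l + 1) / a)) * c (l + 1)) {0..1}"
      unfolding c_def
      by (intro has_integral_mult_right Fourier_coeff_translate theta_holomorphic theta_add_1 a)
    ultimately show ?thesis by (rule has_integral_unique)
  qed
  \<comment> \<open>the recursion for \<open>c\<close> is solved by a Gaussian weight: \<open>(l + 1)\<^sup>2 - l\<^sup>2 = 2 l + 1\<close>\<close>
  define u where "u l = of_real (exp (pi * (of_int l)\<^sup>2 / a)) * c l" for l
  have u_step: "u (l + 1) = u l" for l
    unfolding u_def step[of l]
    by (simp add: power2_eq_square add_divide_distrib ring_distribs exp_add mult_ac)
  have "u l = u 0"
  proof (induction l rule: int_induct[where k = 0])
    case (step2 i) thus ?case using u_step[of "i - 1"] by simp
  qed (auto simp: u_step)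
  hence "of_real (exp (pi * (of_int l)\<^sup>2 / a)) * c l = c 0" by (simp add: u_def)
  thus ?thesis unfolding c_def[symmetric]
    by (simp add: exp_minus field_simps)
qed

lemma dual_dominated:
  assumes "a > 0"
  shows "\<exists>M. M summable_on UNIV \<and>
    (\<forall>l z. norm z < R \<longrightarrow> norm (of_real (exp (- pi * (of_int l)\<^sup>2 / a)) * fourier_exp l z) \<le> M (l::int))"
proof (intro exI conjI allI impI)
  show "(\<lambda>l::int. exp (- (pi / a) * (of_int l)\<^sup>2 + (2 * pi * R) * \<bar>of_int l\<bar> + 0)) summable_on UNIV"
    using assms by (intro summable_gaussian_int) simp
  fix l :: int and z :: complex assume z: "norm z < R"
  have "- (of_int l * Im z) \<le> \<bar>of_int l\<bar> * \<bar>Im z\<bar>"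
    by (simp flip: abs_mult)
  also have "\<dots> \<le> \<bar>of_int l\<bar> * R"
    using z abs_Im_le_cmod[of z] by (intro mult_left_mono) auto
  finally have "pi * - (of_int l * Im z) \<le> pi * (\<bar>of_int l\<bar> * R)"
    by (intro mult_left_mono) auto
  thus "norm (of_real (exp (- pi * (of_int l)\<^sup>2 / a)) * fourier_exp l z)
      \<le> exp (- (pi / a) * (of_int l)\<^sup>2 + (2 * pi * R) * \<bar>of_int l\<bar> + 0)"
    by (simp add: norm_mult fourier_exp_def mult_ac flip: exp_add)
qed

lemma summable_dual:
  assumes "a > 0"
  shows "(\<lambda>l::int. of_real (exp (- pi * (of_int l)\<^sup>2 / a)) * fourier_exp l z) summable_on UNIV"
  by (rule summable_normal[OF _ dual_dominated[OF assms]]) (auto intro!: holomorphic_intros)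

text \<open>
  The classical value is \<open>C = 1 / sqrt a\<close>. Here \<open>C\<close> is the zeroth Fourier coefficient, and its sign is
  read off at \<open>z = 0\<close>, where both series consist of positive terms.
\<close>

theorem theta_Poisson:
  assumes a: "a > 0"
  obtains C :: real where "C \<ge> 0"
    "\<And>z. theta a z = of_real C * (\<Sum>\<^sub>\<infinity>l::int. of_real (exp (- pi * (of_int l)\<^sup>2 / a)) * fourier_exp l z)"
proof -
  define c where "c = Fourier_coeff (theta a) 0"
  have eq: "theta a z = c * (\<Sum>\<^sub>\<infinity>l::int. of_real (exp (- pi * (of_int l)\<^sup>2 / a)) * fourier_exp l z)" for z
  proof (rule LIMSEQ_unique)
    show "(\<lambda>N. \<Sum>l\<in>{- int N..int N}. Fourier_coeff (theta a) l * fourier_exp l z) \<longlonglongrightarrow> theta a z"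
      by (rule Fourier_series[OF theta_holomorphic[OF a] theta_add_1])
    have "((\<lambda>l. c * (of_real (exp (- pi * (of_int l)\<^sup>2 / a)) * fourier_exp l z)) has_sum
        c * (\<Sum>\<^sub>\<infinity>l::int. of_real (exp (- pi * (of_int l)\<^sup>2 / a)) * fourier_exp l z)) UNIV"
      by (intro has_sum_cmult_right has_sum_infsum summable_dual a)
    also have "(\<lambda>l. c * (of_real (exp (- pi * (of_int l)\<^sup>2 / a)) * fourier_exp l z))
        = (\<lambda>l. Fourier_coeff (theta a) l * fourier_exp l z)"
      by (subst Fourier_coeff_theta[OF a]) (simp add: c_def mult_ac)
    finally show "(\<lambda>N. \<Sum>l\<in>{- int N..int N}. Fourier_coeff (theta a) l * fourier_exp l z) \<longlonglongrightarrow>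
        c * (\<Sum>\<^sub>\<infinity>l::int. of_real (exp (- pi * (of_int l)\<^sup>2 / a)) * fourier_exp l z)"
      by (rule has_sum_imp_symmetric_limit)
  qed
  define g where "g b = (\<Sum>\<^sub>\<infinity>k::int. exp (- b * (of_int k)\<^sup>2))" for b :: real
  have gs: "(\<lambda>k::int. exp (- b * (of_int k)\<^sup>2)) summable_on UNIV" if "b > 0" for b :: real
    using summable_gaussian_int[OF that, of 0 0] by simp
  have g_pos: "g b > 0" if "b > 0" for b
  proof -
    have "(\<Sum>\<^sub>\<infinity>k\<in>{0::int}. exp (- b * (of_int k)\<^sup>2)) \<le> g b"
      unfolding g_def by (rule infsum_mono_neutral) (use gs[OF that] in auto)
    thus ?thesis by simp
  qed
  have "theta a 0 = of_real (g (pi * a))"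
    using has_sum_of_real[OF has_sum_infsum[OF gs[of "pi * a"]], where 'a = complex] a
    unfolding theta_def by (intro infsumI) (simp add: g_def exp_of_real[symmetric])
  moreover have "(\<Sum>\<^sub>\<infinity>l::int. of_real (exp (- pi * (of_int l)\<^sup>2 / a)) * fourier_exp l 0) = of_real (g (pi / a))"
    using has_sum_of_real[OF has_sum_infsum[OF gs[of "pi / a"]], where 'a = complex] a
    by (intro infsumI) (simp add: g_def)
  ultimately have "of_real (g (pi * a)) = c * of_real (g (pi / a))"
    using eq[of 0] by metis
  hence "c = of_real (g (pi * a) / g (pi / a))"
    using g_pos[of "pi / a"] a by (simp add: field_simps)
  moreover have "g (pi * a) / g (pi / a) \<ge> 0"
    using g_pos[of "pi / a"] g_pos[of "pi * a"] a by simp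
  ultimately show thesis using eq that by blast
qed

section \<open>Generating functions of Hermite sums\<close>

text \<open>
  The generating function in \<open>t\<close> of the Hermite sums over the points \<open>sqrt a (k + x)\<close>.
\<close>

definition theta_gen :: "real \<Rightarrow> real \<Rightarrow> complex \<Rightarrow> complex" where
  "theta_gen a x t = exp (2 * of_real pi * t\<^sup>2) * theta a (of_real x + 2 * t / of_real (sqrt a))"

lemma theta_gen_holomorphic:
  assumes "a > 0"
  shows "theta_gen a x holomorphic_on UNIV"
  unfolding theta_gen_def[abs_def]
  by (intro holomorphic_intros
      holomorphic_on_compose[OF _ holomorphic_on_subset[OF theta_holomorphic[OF assms]], unfolded o_def])
     (use assms in auto)

lemma theta_gen_add_1: "theta_gen a (x + 1) t = theta_gen a x t"
  using theta_add_1[of a "of_real x + 2 * t / of_real (sqrt a)"]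
  by (simp add: theta_gen_def add_ac)

text \<open>
  On Taylor coefficients in \<open>t\<close> this is the parity \<open>h\<^sub>n (- y) = (- 1)\<^sup>n h\<^sub>n y\<close>, summed over \<open>y\<close>; the points
  \<open>1 - x\<close> and \<open>- x\<close> are the same mod 1.
\<close>

lemma theta_gen_reflect: "theta_gen a (1 - x) t = theta_gen a x (- t)"
proof -
  have "theta a (of_real (1 - x) + 2 * t / of_real (sqrt a))
      = theta a (- (of_real x + 2 * (- t) / of_real (sqrt a)) + 1)"
    by (simp add: algebra_simps)
  also have "\<dots> = theta a (of_real x + 2 * (- t) / of_real (sqrt a))"
    by (simp only: theta_add_1 theta_minus)
  finally show ?thesis by (simp add: theta_gen_def)
qed

text \<open>
  Multiplied by \<open>e\<^bsup>2\<pi>t\<^sup>2\<^esup>\<close>, the \<open>k\<close>-th theta term is \<open>e\<^bsup>\<pi>y\<^sup>2\<^esup> e\<^bsup>-2\<pi>(t+y)\<^sup>2\<^esup>\<close> with \<open>y = sqrt a (k + x)\<close>.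
  Its \<open>n\<close>-th derivative at \<open>t = 0\<close> is the defining expression of \<open>h\<^sub>n y\<close> without the normalising factor.
\<close>

lemma higher_deriv_theta_gen_has_sum:
  assumes a: "a > 0"
  shows "((\<lambda>k::int. complex_of_real (hermite_fun n (sqrt a * (of_int k + x)))) has_sum
    of_real (hermite_const n powr (- 1 / 2)) * (deriv ^^ n) (theta_gen a x) 0) UNIV"
proof -
  define y where "y k = sqrt a * (of_int k + x)" for k :: int
  define T where "T k t = of_real (exp (pi * (y k)\<^sup>2)) * exp (- 2 * of_real pi * (t + of_real (y k))\<^sup>2)"
    for k :: int and t :: complex
  have T: "T k t = exp (2 * of_real pi * t\<^sup>2)
      * exp (- of_real (pi * a) * ((of_real x + 2 * t / of_real (sqrt a)) + of_int k)\<^sup>2)" for k t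
  proof -
    have "complex_of_real a * (of_real x + 2 * t / of_real (sqrt a) + of_int k)\<^sup>2
        = (of_real (sqrt a) * (of_real x + 2 * t / of_real (sqrt a) + of_int k))\<^sup>2"
      using a by (simp add: power_mult_distrib flip: of_real_power)
    also have "of_real (sqrt a) * (of_real x + 2 * t / of_real (sqrt a) + of_int k) = 2 * t + of_real (y k)"
      using a by (simp add: y_def ring_distribs add_ac)
    finally have "complex_of_real a * (of_real x + 2 * t / of_real (sqrt a) + of_int k)\<^sup>2
        = (2 * t + of_real (y k))\<^sup>2" .
    hence "2 * of_real pi * t\<^sup>2 + - of_real (pi * a) * ((of_real x + 2 * t / of_real (sqrt a)) + of_int k)\<^sup>2
        = 2 * of_real pi * t\<^sup>2 - of_real pi * (2 * t + of_real (y k))\<^sup>2"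
      by simp
    also have "\<dots> = of_real (pi * (y k)\<^sup>2) + - 2 * of_real pi * (t + of_real (y k))\<^sup>2"
      by (simp add: power2_eq_square algebra_simps)
    finally show ?thesis
      by (simp only: T_def flip: exp_add exp_of_real)
  qed
  have "((\<lambda>k. (deriv ^^ n) (T k) 0) has_sum (deriv ^^ n) (\<lambda>t. \<Sum>\<^sub>\<infinity>k. T k t) 0) UNIV"
  proof (rule higher_deriv_infsum_normal)
    show "T k holomorphic_on UNIV" for k
      unfolding T_def by (intro holomorphic_intros)
    fix R :: real
    \<comment> \<open>a disc containing every point \<open>x + 2 t / sqrt a\<close> with \<open>norm t < R\<close>\<close>
    define R' where "R' = \<bar>x\<bar> + 2 * \<bar>R\<bar> / sqrt a + 1"
    obtain M where M: "M summable_on UNIV"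
      "\<And>k z. norm z < R' \<Longrightarrow> norm (exp (- of_real (pi * a) * (z + of_int k)\<^sup>2) :: complex) \<le> M (k::int)"
      using theta_dominated[OF a, of R'] by auto
    show "\<exists>M. M summable_on UNIV \<and> (\<forall>k t. norm t < R \<longrightarrow> norm (T k t) \<le> M k)"
    proof (intro exI conjI allI impI)
      show "(\<lambda>k. exp (2 * pi * R\<^sup>2) * M k) summable_on UNIV"
        by (intro summable_on_cmult_right M)
      fix k and t :: complex assume t: "norm t < R"
      have "norm (exp (2 * of_real pi * t\<^sup>2)) \<le> exp (norm (2 * of_real pi * t\<^sup>2))"
        by (rule norm_exp)
      also have "\<dots> \<le> exp (2 * pi * R\<^sup>2)"
        using t by (simp add: norm_mult norm_power power_mono)
      finally have 1: "norm (exp (2 * of_real pi * t\<^sup>2)) \<le> exp (2 * pi * R\<^sup>2)" .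
      have "norm (of_real x + 2 * t / of_real (sqrt a)) \<le> \<bar>x\<bar> + 2 * norm t / sqrt a"
        using norm_triangle_ineq[of "of_real x" "2 * t / of_real (sqrt a)"] a
        by (simp add: norm_mult norm_divide)
      also have "2 * norm t / sqrt a \<le> 2 * \<bar>R\<bar> / sqrt a"
        using t a by (intro divide_right_mono) auto
      finally have "norm (of_real x + 2 * t / of_real (sqrt a)) < R'"
        by (simp add: R'_def)
      from mult_mono[OF 1 M(2)[OF this, of k]] show "norm (T k t) \<le> exp (2 * pi * R\<^sup>2) * M k"
        by (simp only: T norm_mult) simp
    qed
  qed
  also have "(\<lambda>t. \<Sum>\<^sub>\<infinity>k. T k t) = theta_gen a x"
    by (simp add: fun_eq_iff T theta_gen_def theta_def infsum_cmult_right')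
  also have "(\<lambda>k. (deriv ^^ n) (T k) 0)
      = (\<lambda>k. of_real (exp (pi * (y k)\<^sup>2) * (deriv ^^ n) (\<lambda>t. exp (- 2 * pi * t\<^sup>2)) (y k)))"
  proof
    fix k
    have hol: "(\<lambda>z. exp (- 2 * of_real pi * z\<^sup>2)) holomorphic_on (UNIV :: complex set)"
      by (intro holomorphic_intros)
    have "(deriv ^^ n) (T k) 0
        = of_real (exp (pi * (y k)\<^sup>2)) * (deriv ^^ n) (\<lambda>t. exp (- 2 * of_real pi * (1 * t + of_real (y k))\<^sup>2)) 0"
      unfolding T_def mult_1 by (rule higher_deriv_cmult[of _ UNIV]) (auto intro!: holomorphic_intros)
    also have "(deriv ^^ n) (\<lambda>t. exp (- 2 * of_real pi * (1 * t + of_real (y k))\<^sup>2)) (0 :: complex)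
        = (deriv ^^ n) (\<lambda>z. exp (- 2 * of_real pi * z\<^sup>2)) (of_real (y k))"
      using higher_deriv_compose_linear'[OF hol open_UNIV open_UNIV, of 0 1 "of_real (y k)" n] by simp
    also have "\<dots> = of_real ((deriv ^^ n) (\<lambda>t. exp (- 2 * pi * t\<^sup>2)) (y k))"
      by (rule higher_deriv_of_real[OF hol]) (simp flip: exp_of_real)
    finally show "(deriv ^^ n) (T k) 0
        = of_real (exp (pi * (y k)\<^sup>2) * (deriv ^^ n) (\<lambda>t. exp (- 2 * pi * t\<^sup>2)) (y k))"
      by simp
  qed
  finally have "((\<lambda>k. of_real (hermite_const n powr (- 1 / 2)) *
        complex_of_real (exp (pi * (y k)\<^sup>2) * (deriv ^^ n) (\<lambda>t. exp (- 2 * pi * t\<^sup>2)) (y k)))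
      has_sum of_real (hermite_const n powr (- 1 / 2)) * (deriv ^^ n) (theta_gen a x) 0) UNIV"
    by (rule has_sum_cmult_right)
  thus ?thesis by (simp add: hermite_fun_def y_def mult.assoc)
qed

lemma higher_deriv_scale_0:
  assumes "f holomorphic_on UNIV"
  shows "(deriv ^^ n) (\<lambda>t. f (u * t)) 0 = u ^ n * (deriv ^^ n) f (0 :: complex)"
  using higher_deriv_compose_linear[OF assms open_UNIV open_UNIV, of 0 u n] by simp

text \<open>
  The dual lattice sum is to be compared with \<open>s\<close> sums over translates of a coarser lattice, one for each
  residue class.
\<close>

lemma infsum_int_residues:
  fixes f :: "int \<Rightarrow> 'a :: banach"
  assumes s: "s > 0" and f: "f summable_on UNIV"
  shows "(\<Sum>\<^sub>\<infinity>l. f l) = (\<Sum>q<s. \<Sum>\<^sub>\<infinity>k. f (int q + int s * k))"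
proof -
  let ?S = "{..<s} \<times> (UNIV :: int set)"
  have bij: "bij_betw (\<lambda>(q, k). int q + int s * k) ?S UNIV"
    by (rule bij_betw_byWitness[where f' = "\<lambda>l. (nat (l mod int s), l div int s)"])
       (use s in \<open>auto simp: nat_less_iff\<close>)
  have "(\<Sum>\<^sub>\<infinity>l. f l) = (\<Sum>\<^sub>\<infinity>(q, k)\<in>?S. f (int q + int s * k))"
    using infsum_reindex_bij_betw[OF bij, of f] by (simp add: case_prod_unfold)
  also have "\<dots> = (\<Sum>\<^sub>\<infinity>q\<in>{..<s}. \<Sum>\<^sub>\<infinity>k. f (int q + int s * k))"
    using summable_on_reindex_bij_betw[OF bij, of f] f
    by (intro infsum_Sigma'_banach[symmetric]) (simp add: case_prod_unfold)
  finally show ?thesis by simp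
qed

text \<open>
  Write the dual index as \<open>l = q + s k\<close>. At \<open>z = p / s + 2 t / sqrt s\<close> the character of the dual term
  contributes the root of unity depending only on \<open>q\<close>, and completing the square in what remains
  gives again a Gaussian at \<open>q / s + k\<close>, with \<open>t\<close> replaced by \<open>- i t\<close>.
\<close>

lemma theta_gen_Poisson:
  assumes s: "s > 0"
  obtains C :: real where "C \<ge> 0"
    "\<And>p t. theta_gen (real s) (real p / real s) t = of_real C *
      (\<Sum>q<s. fourier_exp (int q) (of_real (real p / real s)) * theta_gen (real s) (real q / real s) (- \<i> * t))"
proof -
  let ?a = "real s"
  obtain C where C: "C \<ge> 0"
    "\<And>z. theta ?a z = of_real C * (\<Sum>\<^sub>\<infinity>l::int. of_real (exp (- pi * (of_int l)\<^sup>2 / ?a)) * fourier_exp l z)"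
    using theta_Poisson[of ?a] s by auto
  have "theta_gen ?a (real p / ?a) t = of_real C *
      (\<Sum>q<s. fourier_exp (int q) (of_real (real p / ?a)) * theta_gen ?a (real q / ?a) (- \<i> * t))" for p t
  proof -
    let ?z = "of_real (real p / ?a) + 2 * t / of_real (sqrt ?a) :: complex"
    have summand: "exp (2 * of_real pi * t\<^sup>2) * (of_real (exp (- pi * (of_int (int q + int s * k))\<^sup>2 / ?a)) * fourier_exp (int q + int s * k) ?z)
        = fourier_exp (int q) (of_real (real p / ?a)) * (exp (2 * of_real pi * (- \<i> * t)\<^sup>2) *
            exp (- of_real (pi * ?a) * (of_real (real q / ?a) + 2 * (- \<i> * t) / of_real (sqrt ?a) + of_int k)\<^sup>2))"
      for q k
    proof -
      define l where "l = int q + int s * k"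
      define r :: complex where "r = of_real (sqrt ?a)"
      \<comment> \<open>rewriting \<open>s\<close> as \<open>r * r\<close> makes the exponent identity one of rational functions\<close>
      have r2: "of_nat s = r * r" and r0: "r \<noteq> 0"
        using s by (simp_all add: r_def flip: of_real_mult)
      have "of_int (int s * k) * complex_of_real (real p / ?a) = of_int (k * int p)"
        using s by simp
      hence "fourier_exp (int s * k) (of_real (real p / ?a)) = 1"
        using fourier_exp_add_int[of 1 0 "k * int p"] by (simp add: fourier_exp_def mult.assoc)
      hence 1: "fourier_exp l (of_real (real p / ?a)) = fourier_exp (int q) (of_real (real p / ?a))"
        by (simp add: l_def fourier_exp_add_freq)
      have 2: "of_real (real q / ?a) + of_int k = complex_of_int l / (r * r)"
        using s r0 by (simp add: l_def field_simps flip: r2)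
      have "2 * of_real pi * t\<^sup>2 + (of_real (- pi * (of_int l)\<^sup>2 / ?a) + 2 * of_real pi * \<i> * of_int l * (2 * t / r))
          = 2 * of_real pi * (- \<i> * t)\<^sup>2 + - of_real (pi * ?a) * (of_int l / (r * r) + 2 * (- \<i> * t) / r)\<^sup>2"
        using r0 by (simp add: r2 power2_eq_square field_simps)
      also have "of_int l / (r * r) + 2 * (- \<i> * t) / r = of_real (real q / ?a) + 2 * (- \<i> * t) / r + of_int k"
        unfolding 2[symmetric] by simp
      finally have "exp (2 * of_real pi * t\<^sup>2) * (of_real (exp (- pi * (of_int l)\<^sup>2 / ?a)) * fourier_exp l (2 * t / r))
          = exp (2 * of_real pi * (- \<i> * t)\<^sup>2) *
            exp (- of_real (pi * ?a) * (of_real (real q / ?a) + 2 * (- \<i> * t) / r + of_int k)\<^sup>2)"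
        by (simp only: fourier_exp_def flip: exp_add exp_of_real)
      from arg_cong[OF this, of "\<lambda>u. fourier_exp (int q) (of_real (real p / ?a)) * u"] show ?thesis
        unfolding l_def[symmetric] r_def[symmetric] fourier_exp_add 1 by (simp only: mult_ac)
    qed
    have "theta_gen ?a (real p / ?a) t
        = of_real C * (exp (2 * of_real pi * t\<^sup>2) * (\<Sum>\<^sub>\<infinity>l::int. of_real (exp (- pi * (of_int l)\<^sup>2 / ?a)) * fourier_exp l ?z))"
      by (simp only: theta_gen_def C(2) mult_ac)
    also have "(\<Sum>\<^sub>\<infinity>l::int. of_real (exp (- pi * (of_int l)\<^sup>2 / ?a)) * fourier_exp l ?z)
        = (\<Sum>q<s. \<Sum>\<^sub>\<infinity>k. of_real (exp (- pi * (of_int (int q + int s * k))\<^sup>2 / ?a)) * fourier_exp (int q + int s * k) ?z)"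
      using s by (intro infsum_int_residues summable_dual) auto
    also have "exp (2 * of_real pi * t\<^sup>2) * \<dots>
        = (\<Sum>q<s. fourier_exp (int q) (of_real (real p / ?a)) * theta_gen ?a (real q / ?a) (- \<i> * t))"
      unfolding sum_distrib_left infsum_cmult_right'[symmetric] summand
      by (simp only: theta_gen_def theta_def infsum_cmult_right')
    finally show ?thesis .
  qed
  with C(1) show thesis by (rule that)
qed

lemma higher_deriv_theta_gen_Poisson:
  assumes s: "s > 0"
  obtains C :: real where "C \<ge> 0"
    "\<And>p. (deriv ^^ n) (theta_gen (real s) (real p / real s)) 0 = of_real C * (- \<i>) ^ n *
      (\<Sum>q<s. fourier_exp (int q) (of_real (real p / real s)) * (deriv ^^ n) (theta_gen (real s) (real q / real s)) 0)"
proof -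
  let ?g = "\<lambda>q. theta_gen (real s) (real q / real s)"
  have hol: "?g q holomorphic_on UNIV" for q
    using s by (intro theta_gen_holomorphic) simp
  have hol': "(\<lambda>t. ?g q (- \<i> * t)) holomorphic_on UNIV" for q
    by (intro holomorphic_on_compose[OF _ holomorphic_on_subset[OF hol], unfolded o_def] holomorphic_intros) auto
  obtain C where C: "C \<ge> 0" "\<And>p t. ?g p t = of_real C * (\<Sum>q<s. fourier_exp (int q) (of_real (real p / real s)) * ?g q (- \<i> * t))"
    using theta_gen_Poisson[OF s] by blast
  have sum: "(deriv ^^ n) (\<lambda>t. \<Sum>q<N. c q * ?g q (- \<i> * t)) 0 = (\<Sum>q<N. c q * ((- \<i>) ^ n * (deriv ^^ n) (?g q) 0))"
    for N and c :: "nat \<Rightarrow> complex"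
  proof (induction N)
    case (Suc N)
    have "(deriv ^^ n) (\<lambda>t. (\<Sum>q<N. c q * ?g q (- \<i> * t)) + c N * ?g N (- \<i> * t)) 0
        = (deriv ^^ n) (\<lambda>t. \<Sum>q<N. c q * ?g q (- \<i> * t)) 0 + (deriv ^^ n) (\<lambda>t. c N * ?g N (- \<i> * t)) 0"
      by (rule higher_deriv_add[of _ UNIV]) (auto intro!: holomorphic_intros hol'[simplified])
    also have "(deriv ^^ n) (\<lambda>t. c N * ?g N (- \<i> * t)) 0 = c N * (deriv ^^ n) (\<lambda>t. ?g N (- \<i> * t)) 0"
      by (rule higher_deriv_cmult[OF hol']) auto
    finally show ?case
      by (simp only: Suc higher_deriv_scale_0[OF hol] sum.lessThan_Suc)
  qed simp
  have "(deriv ^^ n) (?g p) 0 = of_real C * (- \<i>) ^ n *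
      (\<Sum>q<s. fourier_exp (int q) (of_real (real p / real s)) * (deriv ^^ n) (?g q) 0)" for p
  proof -
    have "?g p = (\<lambda>t. \<Sum>q<s. (of_real C * fourier_exp (int q) (of_real (real p / real s))) * ?g q (- \<i> * t))"
      using C(2)[of p] by (simp add: fun_eq_iff sum_distrib_left mult.assoc)
    from arg_cong[OF this, of "\<lambda>g. (deriv ^^ n) g 0"]
    show ?thesis unfolding sum by (simp add: sum_distrib_left mult_ac)
  qed
  with C(1) show thesis by (rule that)
qed

text \<open>
  The values at \<open>p / s\<close> and \<open>(s - p) / s\<close> are opposite, so those at \<open>0\<close> and \<open>1 / 2\<close> vanish. For \<open>s = 3\<close>
  and \<open>s = 4\<close> this leaves the value at \<open>1 / s\<close>, which the Poisson relation sends to a multiple of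
  itself by a factor \<open>\<le> 0\<close>.
\<close>

lemma higher_deriv_theta_gen_eq_0:
  assumes n: "n = 4 * m + 3" and s: "s \<in> {2, 3, 4 :: nat}" and p: "p < s"
  shows "(deriv ^^ n) (theta_gen (real s) (real p / real s)) 0 = 0"
proof -
  define D where "D x = (deriv ^^ n) (theta_gen (real s) x) 0" for x
  have s0: "s > 0" using s by auto
  have reflect: "D (1 - x) = - D x" for x
  proof -
    have "theta_gen (real s) (1 - x) = (\<lambda>t. theta_gen (real s) x (- 1 * t))"
      by (simp add: fun_eq_iff theta_gen_reflect)
    hence "D (1 - x) = (- 1) ^ n * D x"
      using s0 by (simp only: D_def) (intro higher_deriv_scale_0 theta_gen_holomorphic, simp)
    thus ?thesis by (simp add: n)
  qed
  have D0: "D 0 = 0"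
  proof -
    have "theta_gen (real s) 1 = theta_gen (real s) 0"
      using theta_gen_add_1[of "real s" 0] by (simp add: fun_eq_iff)
    with reflect[of 0] show ?thesis by (simp add: D_def eq_neg_iff_add_eq_0)
  qed
  have Dhalf: "D (1 / 2) = 0"
    using reflect[of "1 / 2"] by (simp add: eq_neg_iff_add_eq_0)
  have D1: "D (1 / real s) = 0" if s34: "s = 3 \<or> s = 4"
  proof -
    obtain C where C: "C \<ge> 0" "\<And>p. D (real p / real s) = of_real C * (- \<i>) ^ n *
        (\<Sum>q<s. fourier_exp (int q) (of_real (real p / real s)) * D (real q / real s))"
      using higher_deriv_theta_gen_Poisson[OF s0, of n] unfolding D_def by blast
    let ?x = "complex_of_real (1 / real s)"
    have "(- \<i>) ^ 4 = 1" "(- \<i>) ^ 3 = \<i>"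
      by (simp_all add: numeral_eq_Suc)
    hence "(- \<i>) ^ n = \<i>"
      by (simp add: n power_add power_mult)
    moreover have "(\<Sum>q<s. fourier_exp (int q) ?x * D (real q / real s)) = (fourier_exp 1 ?x - fourier_exp (int s - 1) ?x) * D (1 / real s)"
      using s34
    proof
      assume "s = 3"
      thus ?thesis using reflect[of "1 / 3"] by (simp add: eval_nat_numeral D0 algebra_simps)
    next
      assume "s = 4"
      thus ?thesis using reflect[of "1 / 4"] Dhalf by (simp add: eval_nat_numeral D0 algebra_simps)
    qed
    \<comment> \<open>by oddness only the residues \<open>q = 1\<close> and \<open>q = s - 1\<close> contribute, with opposite signs\<close>
    moreover have "fourier_exp 1 ?x - fourier_exp (int s - 1) ?x = 2 * \<i> * of_real (sin (2 * pi / real s))"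
    proof -
      have "fourier_exp (int s) ?x = 1"
        using s0 fourier_exp_add_int[of 1 0 1] by (simp add: fourier_exp_def)
      hence "fourier_exp (int s - 1) ?x = fourier_exp (- 1) ?x"
        using fourier_exp_add_freq[of "int s" "- 1" ?x] by simp
      moreover have "fourier_exp 1 ?x = cis (2 * pi / real s)" "fourier_exp (- 1) ?x = cis (- (2 * pi / real s))"
        by (simp_all add: fourier_exp_def cis_conv_exp mult_ac)
      ultimately show ?thesis by (simp add: complex_eq_iff)
    qed
    ultimately have "D (1 / real s) = - of_real (2 * C * sin (2 * pi / real s)) * D (1 / real s)"
      using C(2)[of 1] by (simp add: mult_ac)
    hence "of_real (1 + 2 * C * sin (2 * pi / real s)) * D (1 / real s) = 0"
      unfolding eq_neg_iff_add_eq_0 mult_minus_left by (simp only: of_real_add of_real_1 ring_distribs mult_1)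
    moreover have "sin (2 * pi / real s) > 0"
      using s34 by (intro sin_gt_zero) auto
    hence "1 + 2 * C * sin (2 * pi / real s) > 0"
      using C(1) by (intro add_pos_nonneg mult_nonneg_nonneg) auto
    ultimately show ?thesis
      by (metis less_irrefl mult_eq_0_iff of_real_eq_0_iff)
  qed
  have "p \<in> {0, 1, s - 1} \<or> s = 4 \<and> p = 2" using s p by auto
  hence "D (real p / real s) = 0"
  proof (elim disjE conjE)
    assume "p \<in> {0, 1, s - 1}"
    moreover have D1': "D (1 / real s) = 0"
      using s D1 Dhalf by auto
    moreover have "D (real (s - 1) / real s) = 0"
    proof -
      have "real (s - 1) / real s = 1 - 1 / real s"
        using s0 by (simp add: of_nat_diff field_simps)
      thus ?thesis using D1' reflect[of "1 / real s"] by simp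
    qed
    ultimately show ?thesis using D0 by auto
  next
    assume "s = 4" "p = 2"
    thus ?thesis using Dhalf by simp
  qed
  thus ?thesis by (simp add: D_def)
qed

section \<open>Vanishing of the Zak transform\<close>

theorem lemma4:
  fixes m n s p :: nat
  assumes "n = 4 * m + 3"
    and "s \<in> {2, 3, 4}"
    and "p \<in> {0..s - 1}"
  shows "(\<lambda>k::int. \<bar>hermite_fun n (sqrt (real s) * (of_int k + real p / real s))\<bar>)
           summable_on UNIV
    \<and> zak (sqrt (real s)) (\<lambda>t. complex_of_real (hermite_fun n t)) (real p / real s) 0
        = complex_of_real (real s powr (1 / 4) *
            (\<Sum>\<^sub>\<infinity>k::int. hermite_fun n (sqrt (real s) * (of_int k + real p / real s))))
    \<and> real s powr (1 / 4) *
        (\<Sum>\<^sub>\<infinity>k::int. hermite_fun n (sqrt (real s) * (of_int k + real p / real s))) = 0"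
proof -
  let ?h = "\<lambda>k::int. hermite_fun n (sqrt (real s) * (of_int k + real p / real s))"
  have s: "s > 0" and p: "p < s" using assms(2,3) by auto
  have c: "((\<lambda>k. complex_of_real (?h k)) has_sum of_real 0) UNIV"
    using higher_deriv_theta_gen_has_sum[of "real s" n "real p / real s"] s
      higher_deriv_theta_gen_eq_0[OF assms(1,2) p] by simp
  hence r: "(?h has_sum 0) UNIV"
    unfolding has_sum_of_real_iff .
  have "(\<lambda>k. norm (?h k)) summable_on UNIV"
    using has_sum_imp_summable[OF r] by (rule summable_on_iff_abs_summable_on_real[THEN iffD1])
  moreover have "(\<Sum>\<^sub>\<infinity>k. ?h k) = 0"
    using r by (rule infsumI)
  moreover have "zak (sqrt (real s)) (\<lambda>t. complex_of_real (hermite_fun n t)) (real p / real s) 0 = 0"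
    using infsumI[OF c] by (simp add: zak_def add.commute[of "real p / real s"])
  ultimately show ?thesis by simp
qed

end
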